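(* The categories $\mathsf{SLataSp}$ (SLata-spaces and SLata-relations) and $\mathsf{RelSP}$ (RelS-spaces and adjoint-preserving relations) are isomorphic.
   Context: **S-spaces.** Let $X$ be a set and $\mathcal{K}\subseteq\mathcal{P}(X)$, regarded as a subbase of a topology on $X$. Put $S(X)=\{U^c: U\in\mathcal{K}\}$ and $\mathcal{C}_{\mathcal{K}}(X)=\{\bigcap\mathcal{A}:\mathcal{A}\subseteq S(X)\}$. For $Y\subseteq X$, a family $\mathcal{J}\subseteq S(X)$ is a $Y$-family if for all $A,B\in\mathcal{J}$ there are $H\in S(X)$, $C\in\mathcal{J}$ with $Y\subseteq H$, $A\cap H\subseteq C$ and $B\cap H\subseteq C$. $\langle X,\mathcal{K}\rangle$ is an S-space if: (S1) the topology is $T_0$ and $X=\bigcup\mathcal{K}$; (S2) $\mathcal{K}$ is a subbase of compact open sets, closed under finite unions, and $\emptyset\in\mathcal{K}$; (S3) if $x\in U\cap V$ with $U,V\in\mathcal{K}$, there are $W,D\in\mathcal{K}$ with $x\notin W$, $x\in D$, $D\subseteq(U\cap V)\cup W$; (S4) if $Y\in\mathcal{C}_{\mathcal{K}}(X)$ and $\mathcal{J}\subseteq S(X)$ is a $Y$-family with $Y\cap A^c\neq\emptyset$ for all $A\in\mathcal{J}$, then $Y\cap\bigcap\{A^c:A\in\mathcal{J}\}\neq\emptyset$. Put $\mathrm{cl}_{\mathcal{K}}(x)=\bigcap\{U\in S(X):x\in U\}$. The dual specialization order is: $x\sqsupseteq_X y$ iff $y\in\mathrm{cl}_{\mathcal{K}}(x)$;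 relative to it, $\uparrow x=\mathrm{cl}_{\mathcal{K}}(x)$. **Meet-relations.** For a relation $T\subseteq X\times Y$ write $T(x)=\{y:(x,y)\in T\}$ and $\Box_T(U)=\{x\in X:T(x)\subseteq U\}$. A meet-relation between S-spaces $\langle X_1,\mathcal{K}_1\rangle$ and $\langle X_2,\mathcal{K}_2\rangle$ is $T\subseteq X_1\times X_2$ such that $\Box_T(U)\in S(X_1)$ for all $U\in S(X_2)$, and $T(x)=\bigcap\{U\in S(X_2):T(x)\subseteq U\}$ for all $x\in X_1$. For relations $R\subseteq X_1\times X_2$, $T\subseteq X_2\times X_3$ between S-spaces, put $T*R=\{(x,z)\in X_1\times X_3:\forall U\in S(X_3)\,((T\circ R)(x)\subseteq U\Rightarrow z\in U)\}$, where $(T\circ R)(x)=\bigcup_{y\in R(x)}T(y)$. **mS-spaces.** $\mathcal{Z}(X)$ is the set of all $Z=\bigcap\mathcal{L}$ with $\mathcal{L}\subseteq\mathcal{K}$ non-empty and dually directed under $\subseteq$ (any two members of $\mathcal{L}$ contain a common member of $\mathcal{L}$). For $U\in S(X)$, $L_U=\{Z\in\mathcal{Z}(X):Z\cap U\neq\emptyset\}$. An mS-space is $\langle X,\mathcal{K},R\rangle$ with $\langle X,\mathcal{K}\rangle$ an S-space and $R\subseteq X\times\mathcal{Z}(X)$ such that, with $R(x)=\{Z:(x,Z)\in R\}$ and $m_R(U)=\{x\in X:R(x)\subseteq L_U\}$: (m1) $m_R(U)\in S(X)$ for all $U\in S(X)$; (m2) $R(x)=\bigcap\{L_U:U\in S(X),\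 x\in m_R(U)\}$ for all $x\in X$. A meet-relation $T\subseteq X_1\times X_2$ between mS-spaces $\langle X_j,\mathcal{K}_j,R_j\rangle$ is monotone if $\Box_T\circ m_{R_2}=m_{R_1}\circ\Box_T$ on $S(X_2)$. **$\mathsf{SLataSp}$.** An SLata-space is $\langle X,\mathcal{K},I,E\rangle$ such that: (A1) $\langle X,\mathcal{K},I\rangle$ and $\langle X,\mathcal{K},E\rangle$ are mS-spaces; (A2) for every $U\in S(X)$, if $x\in U$ then for every $Z\in E(x)$ there is $w\in Z$ with $I(w)\subseteq L_U$; (A3) for every $U\in S(X)$, if for every $Z\in I(x)$ there is $y\in Z$ with $E(y)\subseteq L_U$, then $x\in U$. An SLata-relation between SLata-spaces is a meet-relation that is monotone with respect to both the $I$'s and the $E$'s. $\mathsf{SLataSp}$ has SLata-spaces as objects, SLata-relations as morphisms, composition $*$, and identities $\sqsupseteq_X$. **$\mathsf{RelSP}$.** For an S-space and $U\in S(X)$ let $D_U=\{Y\in\mathcal{C}_{\mathcal{K}}(X):Y\subseteq U\}$. A relation $T\subseteq X\times X$ on an S-space $\langle X,\mathcal{K}\rangle$ is an A-relation if: (1) $\Box_T(U)\in S(X)$ for every $U\in S(X)$; (2) for all $U\in S(X)$, $\bigcap F_U^T\in S(X)$, where $F_U^T=\{V\in S(X):U\subseteq\Box_T(V)\}$. A RelS-space is $\langle X,\mathcal{K},T\rangle$ where $\langle X,\mathcal{K}\rangle$ is an S-space and $T\subseteq X\times X$ is an A-relation. Given RelS-spaces $\langle X,\mathcal{K}_X,T_X\rangle$,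 $\langle Y,\mathcal{K}_Y,T_Y\rangle$, a relation $M\subseteq X\times Y$ is adjoint-preserving if: (1) $M$ is a meet-relation; (2) $M*T_X=T_Y*M$; (3) for every $x\in X$, $U\in S(X)$ and $V\in S(Y)$: $(M(x)\in D_V\Rightarrow T_X(x)\in D_U)\Rightarrow(M(x)\in\bigcap_{W\in F_V^{T_Y}}D_W\Rightarrow\ \uparrow x\in D_U)$. $\mathsf{RelSP}$ has RelS-spaces as objects, adjoint-preserving relations as morphisms, composition $*$, and identities $\sqsupseteq_X$.
   Formalization: In (S4) J is non-empty (else no S-space exists); RelS-spaces also require T(x) in C_K(X) for all x, and in adjoint-preserving (3) "for every x" is read inside each inner implication (else RelSP is not a category); points range over an arbitrary fixed universe. *)

theory Defs
  imports "HOL-Analysis.Analysis"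
begin

section \<open>S-spaces\<close>

text \<open>
  A set of points with a family of its subsets that is used as a subbase.  The structures below
  extend this record, so every notion about the underlying space applies to them directly.
  For a relation \<open>T\<close>, the set written \<open>T(x)\<close> on paper is \<open>T `` {x}\<close>.
\<close>

record 'a subbased =
  pts :: "'a set"
  sub :: "'a set set"

definition top_of :: "('a, 'z) subbased_scheme \<Rightarrow> 'a topology" where
  "top_of X = topology_generated_by (sub X)"

definition S_sets :: "('a, 'z) subbased_scheme \<Rightarrow> 'a set set" where
  "S_sets X = {pts X - U | U. U \<in> sub X}"

text \<open>Intersections are taken inside the set of points; in particular the intersection of the
  empty family is the whole set of points.\<close>

definition C_sets :: "('a, 'z) subbased_scheme \<Rightarrow> 'a set set" where
  "C_sets X = {pts X \<inter> \<Inter>\<A> | \<A>. \<A> \<subseteq> S_sets X}"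

definition Y_family :: "('a, 'z) subbased_scheme \<Rightarrow> 'a set \<Rightarrow> 'a set set \<Rightarrow> bool" where
  "Y_family X Y \<J> \<longleftrightarrow> \<J> \<subseteq> S_sets X \<and>
     (\<forall>A\<in>\<J>. \<forall>B\<in>\<J>. \<exists>H\<in>S_sets X. \<exists>C\<in>\<J>. Y \<subseteq> H \<and> A \<inter> H \<subseteq> C \<and> B \<inter> H \<subseteq> C)"

text \<open>
  The four clause groups are (S1)--(S4).  Note that \<open>topspace (top_of X) = \<Union>(sub X)\<close>.
  In (S4) the family \<open>\<J>\<close> is required to be non-empty.  This is implicit on paper: by (S1) the
  empty set is the intersection of \<open>S_sets X\<close> and hence a member of \<open>C_sets X\<close>, so
  with \<open>Y = {}\<close> and \<open>\<J> = {}\<close> admitted, (S4) would fail in every space.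
\<close>

definition S_space :: "('a, 'z) subbased_scheme \<Rightarrow> bool" where
  "S_space X \<longleftrightarrow>
     (t0_space (top_of X) \<and> pts X = \<Union>(sub X)) \<and>
     ((\<forall>U\<in>sub X. openin (top_of X) U \<and> compactin (top_of X) U) \<and>
      (\<forall>U\<in>sub X. \<forall>V\<in>sub X. U \<union> V \<in> sub X) \<and> {} \<in> sub X) \<and>
     (\<forall>x. \<forall>U\<in>sub X. \<forall>V\<in>sub X. x \<in> U \<inter> V \<longrightarrow>
        (\<exists>W\<in>sub X. \<exists>D\<in>sub X. x \<notin> W \<and> x \<in> D \<and> D \<subseteq> (U \<inter> V) \<union> W)) \<and>
     (\<forall>Y\<in>C_sets X. \<forall>\<J>. \<J> \<noteq> {} \<and> Y_family X Y \<J> \<and> (\<forall>A\<in>\<J>. Y \<inter> (pts X - A) \<noteq> {}) \<longrightarrow>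
        Y \<inter> (\<Inter>A\<in>\<J>. pts X - A) \<noteq> {})"

definition cl :: "('a, 'z) subbased_scheme \<Rightarrow> 'a \<Rightarrow> 'a set" where
  "cl X x = pts X \<inter> \<Inter>{U \<in> S_sets X. x \<in> U}"

definition dual_spec :: "('a, 'z) subbased_scheme \<Rightarrow> ('a \<times> 'a) set" where
  "dual_spec X = {(x, y). x \<in> pts X \<and> y \<in> cl X x}"


section \<open>Meet-relations\<close>

definition boxR :: "('a, 'z) subbased_scheme \<Rightarrow> ('a \<times> 'b) set \<Rightarrow> 'b set \<Rightarrow> 'a set" where
  "boxR X T U = {x \<in> pts X. T `` {x} \<subseteq> U}"

definition meet_relation ::
  "('a, 'y) subbased_scheme \<Rightarrow> ('b, 'z) subbased_scheme \<Rightarrow> ('a \<times> 'b) set \<Rightarrow> bool" where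
  "meet_relation X Y T \<longleftrightarrow> T \<subseteq> pts X \<times> pts Y \<and>
     (\<forall>U\<in>S_sets Y. boxR X T U \<in> S_sets X) \<and>
     (\<forall>x\<in>pts X. T `` {x} = pts Y \<inter> \<Inter>{U \<in> S_sets Y. T `` {x} \<subseteq> U})"

text \<open>\<open>star X Z T R\<close> is \<open>T * R\<close> for a relation \<open>R\<close> from \<open>X\<close> to some space and a relation \<open>T\<close> from
  that space to \<open>Z\<close>; \<open>R O T\<close> is the composite that applies \<open>R\<close> first.\<close>

definition star ::
  "('a, 'y) subbased_scheme \<Rightarrow> ('c, 'z) subbased_scheme \<Rightarrow>
   ('b \<times> 'c) set \<Rightarrow> ('a \<times> 'b) set \<Rightarrow> ('a \<times> 'c) set" where
  "star X Z T R = {(x, z) \<in> pts X \<times> pts Z. \<forall>U\<in>S_sets Z. (R O T) `` {x} \<subseteq> U \<longrightarrow> z \<in> U}"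


section \<open>mS-spaces\<close>

definition Z_sets :: "('a, 'z) subbased_scheme \<Rightarrow> 'a set set" where
  "Z_sets X = {\<Inter>\<L> | \<L>. \<L> \<subseteq> sub X \<and> \<L> \<noteq> {} \<and> (\<forall>A\<in>\<L>. \<forall>B\<in>\<L>. \<exists>C\<in>\<L>. C \<subseteq> A \<inter> B)}"

definition L_set :: "('a, 'z) subbased_scheme \<Rightarrow> 'a set \<Rightarrow> 'a set set" where
  "L_set X U = {Z \<in> Z_sets X. Z \<inter> U \<noteq> {}}"

definition m_op :: "('a, 'z) subbased_scheme \<Rightarrow> ('a \<times> 'a set) set \<Rightarrow> 'a set \<Rightarrow> 'a set" where
  "m_op X R U = {x \<in> pts X. R `` {x} \<subseteq> L_set X U}"

definition mS_space :: "('a, 'z) subbased_scheme \<Rightarrow> ('a \<times> 'a set) set \<Rightarrow> bool" where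
  "mS_space X R \<longleftrightarrow> S_space X \<and> R \<subseteq> pts X \<times> Z_sets X \<and>
     (\<forall>U\<in>S_sets X. m_op X R U \<in> S_sets X) \<and>
     (\<forall>x\<in>pts X. R `` {x} = Z_sets X \<inter> \<Inter>{L_set X U | U. U \<in> S_sets X \<and> x \<in> m_op X R U})"

definition monotone_rel ::
  "('a, 'y) subbased_scheme \<Rightarrow> ('a \<times> 'a set) set \<Rightarrow>
   ('b, 'z) subbased_scheme \<Rightarrow> ('b \<times> 'b set) set \<Rightarrow> ('a \<times> 'b) set \<Rightarrow> bool" where
  "monotone_rel X R Y Q T \<longleftrightarrow> (\<forall>U\<in>S_sets Y. boxR X T (m_op Y Q U) = m_op X R (boxR X T U))"


section \<open>SLata-spaces and RelS-spaces\<close>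

record 'a slata = "'a subbased" +
  relI :: "('a \<times> 'a set) set"
  relE :: "('a \<times> 'a set) set"

definition SLata_space :: "'a slata \<Rightarrow> bool" where
  "SLata_space X \<longleftrightarrow>
     (mS_space X (relI X) \<and> mS_space X (relE X)) \<and>
     (\<forall>U\<in>S_sets X. \<forall>x\<in>pts X. x \<in> U \<longrightarrow>
        (\<forall>Z\<in>relE X `` {x}. \<exists>w\<in>Z. relI X `` {w} \<subseteq> L_set X U)) \<and>
     (\<forall>U\<in>S_sets X. \<forall>x\<in>pts X.
        (\<forall>Z\<in>relI X `` {x}. \<exists>y\<in>Z. relE X `` {y} \<subseteq> L_set X U) \<longrightarrow> x \<in> U)"

definition SLata_relation :: "'a slata \<Rightarrow> 'b slata \<Rightarrow> ('a \<times> 'b) set \<Rightarrow> bool" where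
  "SLata_relation X Y T \<longleftrightarrow> meet_relation X Y T \<and>
     monotone_rel X (relI X) Y (relI Y) T \<and> monotone_rel X (relE X) Y (relE Y) T"

record 'a rels = "'a subbased" +
  relT :: "('a \<times> 'a) set"

definition D_set :: "('a, 'z) subbased_scheme \<Rightarrow> 'a set \<Rightarrow> 'a set set" where
  "D_set X U = {Y \<in> C_sets X. Y \<subseteq> U}"

definition F_set :: "('a, 'z) subbased_scheme \<Rightarrow> ('a \<times> 'a) set \<Rightarrow> 'a set \<Rightarrow> 'a set set" where
  "F_set X T U = {V \<in> S_sets X. U \<subseteq> boxR X T V}"

definition A_relation :: "('a, 'z) subbased_scheme \<Rightarrow> ('a \<times> 'a) set \<Rightarrow> bool" where
  "A_relation X T \<longleftrightarrow> T \<subseteq> pts X \<times> pts X \<and>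
     (\<forall>U\<in>S_sets X. boxR X T U \<in> S_sets X) \<and>
     (\<forall>U\<in>S_sets X. pts X \<inter> \<Inter>(F_set X T U) \<in> S_sets X)"

text \<open>
  The last conjunct, that every \<open>T(x)\<close> lies in \<open>C_sets X\<close> (equivalently, that \<open>T\<close> is a meet-relation),
  is tacit on paper: it is presupposed when \<open>T(x)\<close> is compared with \<open>D_set X U\<close>, a family of members
  of \<open>C_sets X\<close>, in the definition of adjoint-preserving relations.  Without it these relations are not closed
  under \<open>star\<close>: a relation \<open>T\<close> and the relation with values the closures of the \<open>T(x)\<close> have the
  same \<open>boxR\<close> on \<open>S_sets X\<close>, but condition (3) below is void wherever \<open>T(x)\<close> is not in \<open>C_sets X\<close>.
\<close>

definition RelS_space :: "'a rels \<Rightarrow> bool" where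
  "RelS_space X \<longleftrightarrow> S_space X \<and> A_relation X (relT X) \<and> (\<forall>x\<in>pts X. relT X `` {x} \<in> C_sets X)"

text \<open>
  The last conjunct is condition (3).  For fixed \<open>U\<close> and \<open>V\<close>, each of its two inner implications is a
  statement about all points \<open>x\<close>, i.e. an inclusion of sets: if \<open>boxR X M V \<subseteq> boxR X T\<^sub>X U\<close> then
  \<open>boxR X M (\<Inter>(F_set Y T\<^sub>Y V)) \<subseteq> U\<close>.  With a single quantifier over \<open>x\<close> governing the outer implication,
  the identity \<open>dual_spec X\<close> would in general fail the condition.
\<close>

definition adjoint_preserving :: "'a rels \<Rightarrow> 'b rels \<Rightarrow> ('a \<times> 'b) set \<Rightarrow> bool" where
  "adjoint_preserving X Y M \<longleftrightarrow>
     meet_relation X Y M \<and>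
     star X Y M (relT X) = star X Y (relT Y) M \<and>
     (\<forall>U\<in>S_sets X. \<forall>V\<in>S_sets Y.
        (\<forall>x\<in>pts X. M `` {x} \<in> D_set Y V \<longrightarrow> relT X `` {x} \<in> D_set X U) \<longrightarrow>
        (\<forall>x\<in>pts X. M `` {x} \<in> (\<Inter>W\<in>F_set Y (relT Y) V. D_set Y W) \<longrightarrow> cl X x \<in> D_set X U))"


section \<open>Categories and their isomorphism\<close>

text \<open>\<open>Comp C a b c g f\<close> is the composite of \<open>f\<close> in \<open>Hom C a b\<close> and \<open>g\<close> in \<open>Hom C b c\<close>.
  Hom-sets of different pairs of objects need not be disjoint; arrows are always considered
  together with their domain and codomain.\<close>

record ('o, 'm) category_data =
  Obj :: "'o set"
  Hom :: "'o \<Rightarrow> 'o \<Rightarrow> 'm set"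
  Comp :: "'o \<Rightarrow> 'o \<Rightarrow> 'o \<Rightarrow> 'm \<Rightarrow> 'm \<Rightarrow> 'm"
  Ident :: "'o \<Rightarrow> 'm"

definition is_category :: "('o, 'm) category_data \<Rightarrow> bool" where
  "is_category C \<longleftrightarrow>
     (\<forall>a\<in>Obj C. Ident C a \<in> Hom C a a) \<and>
     (\<forall>a\<in>Obj C. \<forall>b\<in>Obj C. \<forall>c\<in>Obj C. \<forall>f\<in>Hom C a b. \<forall>g\<in>Hom C b c. Comp C a b c g f \<in> Hom C a c) \<and>
     (\<forall>a\<in>Obj C. \<forall>b\<in>Obj C. \<forall>f\<in>Hom C a b.
        Comp C a a b f (Ident C a) = f \<and> Comp C a b b (Ident C b) f = f) \<and>
     (\<forall>a\<in>Obj C. \<forall>b\<in>Obj C. \<forall>c\<in>Obj C. \<forall>d\<in>Obj C.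
        \<forall>f\<in>Hom C a b. \<forall>g\<in>Hom C b c. \<forall>h\<in>Hom C c d.
        Comp C a b d (Comp C b c d h g) f = Comp C a c d h (Comp C a b c g f))"

definition is_functor ::
  "('o, 'm) category_data \<Rightarrow> ('p, 'n) category_data \<Rightarrow> ('o \<Rightarrow> 'p) \<Rightarrow> ('o \<Rightarrow> 'o \<Rightarrow> 'm \<Rightarrow> 'n) \<Rightarrow> bool" where
  "is_functor C D Fo Fa \<longleftrightarrow>
     (\<forall>a\<in>Obj C. Fo a \<in> Obj D) \<and>
     (\<forall>a\<in>Obj C. \<forall>b\<in>Obj C. \<forall>f\<in>Hom C a b. Fa a b f \<in> Hom D (Fo a) (Fo b)) \<and>
     (\<forall>a\<in>Obj C. Fa a a (Ident C a) = Ident D (Fo a)) \<and>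
     (\<forall>a\<in>Obj C. \<forall>b\<in>Obj C. \<forall>c\<in>Obj C. \<forall>f\<in>Hom C a b. \<forall>g\<in>Hom C b c.
        Fa a c (Comp C a b c g f) = Comp D (Fo a) (Fo b) (Fo c) (Fa b c g) (Fa a b f))"

definition left_inverse_functor ::
  "('o, 'm) category_data \<Rightarrow> ('o \<Rightarrow> 'p) \<Rightarrow> ('o \<Rightarrow> 'o \<Rightarrow> 'm \<Rightarrow> 'n) \<Rightarrow>
   ('p \<Rightarrow> 'o) \<Rightarrow> ('p \<Rightarrow> 'p \<Rightarrow> 'n \<Rightarrow> 'm) \<Rightarrow> bool" where
  "left_inverse_functor C Fo Fa Go Ga \<longleftrightarrow>
     (\<forall>a\<in>Obj C. Go (Fo a) = a) \<and>
     (\<forall>a\<in>Obj C. \<forall>b\<in>Obj C. \<forall>f\<in>Hom C a b. Ga (Fo a) (Fo b) (Fa a b f) = f)"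

definition isomorphic_categories ::
  "('o, 'm) category_data \<Rightarrow> ('p, 'n) category_data \<Rightarrow> bool" where
  "isomorphic_categories C D \<longleftrightarrow> is_category C \<and> is_category D \<and>
     (\<exists>Fo Fa Go Ga. is_functor C D Fo Fa \<and> is_functor D C Go Ga \<and>
        left_inverse_functor C Fo Fa Go Ga \<and> left_inverse_functor D Go Ga Fo Fa)"

text \<open>The objects of the two categories are the spaces whose points are elements of the type \<open>'a\<close>,
  which plays the role of an arbitrary universe of points.\<close>

definition SLataSp :: "('a slata, ('a \<times> 'a) set) category_data" where
  "SLataSp = \<lparr> Obj = {X. SLata_space X}, Hom = (\<lambda>X Y. {T. SLata_relation X Y T}),
     Comp = (\<lambda>X Y Z T R. star X Z T R), Ident = (\<lambda>X. dual_spec X) \<rparr>"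

definition RelSP :: "('a rels, ('a \<times> 'a) set) category_data" where
  "RelSP = \<lparr> Obj = {X. RelS_space X}, Hom = (\<lambda>X Y. {M. adjoint_preserving X Y M}),
     Comp = (\<lambda>X Y Z T R. star X Z T R), Ident = (\<lambda>X. dual_spec X) \<rparr>"

end

(* A meet-relation T is the same thing as a map on the semilattices S(-) preserving finite
   intersections, via T |-> Box_T, and a multirelation R of an mS-space is the same thing as a
   monotone map, via R |-> m_R.  The star product becomes composition of maps.  Conditions (A2) and
   (A3) say that m_I is left adjoint to m_E.  Hence m_E preserves finite intersections and is Box_T
   for a unique meet-relation T, while m_I is recovered as U |-> Inter F_U^T, so that (I, E) and T
   determine each other.  A meet-relation commuting with m_E satisfies one half of commutation
   with m_I automatically, and condition (3) is the other half. *)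

theory Submission
  imports Defs
begin

section \<open>The semilattice of an S-space\<close>

lemma S_sets_subset: "U \<in> S_sets X \<Longrightarrow> U \<subseteq> pts X"
  by (auto simp: S_sets_def)

lemma S_sets_Int:
  assumes "S_space X" "U \<in> S_sets X" "V \<in> S_sets X"
  shows "U \<inter> V \<in> S_sets X"
proof -
  obtain A B where "A \<in> sub X" "B \<in> sub X" "U = pts X - A" "V = pts X - B"
    using assms(2,3) by (auto simp: S_sets_def)
  moreover from this have "A \<union> B \<in> sub X"
    using assms(1) by (simp add: S_space_def)
  ultimately show ?thesis
    unfolding S_sets_def by (intro CollectI exI[of _ "A \<union> B"]) auto
qed

lemma pts_in_S_sets: "S_space X \<Longrightarrow> pts X \<in> S_sets X"
  unfolding S_sets_def by (intro CollectI exI[of _ "{}"]) (simp add: S_space_def)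

lemma compl_S_set_in_sub:
  assumes "S_space X" "U \<in> S_sets X"
  shows "pts X - U \<in> sub X"
proof -
  obtain A where "A \<in> sub X" "U = pts X - A"
    using assms(2) by (auto simp: S_sets_def)
  moreover from this have "A \<subseteq> pts X"
    using assms(1) by (auto simp: S_space_def)
  ultimately show ?thesis
    by (simp add: double_diff)
qed

lemma S_sets_finite_Inter:
  assumes "S_space X" "finite F" "F \<subseteq> S_sets X"
  shows "pts X \<inter> \<Inter>F \<in> S_sets X"
  using assms(2,3)
proof (induction F rule: finite_induct)
  case empty
  then show ?case using pts_in_S_sets[OF assms(1)] by simp
next
  case (insert U F)
  then have "U \<inter> (pts X \<inter> \<Inter>F) \<in> S_sets X"
    by (simp add: S_sets_Int[OF assms(1)] del: Int_iff)
  then show ?case by (simp add: Int_left_commute)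
qed

text \<open>This is the compactness of the complement of \<open>U\<close>.\<close>

lemma S_sets_finite_Inter_subset:
  assumes X: "S_space X" and U: "U \<in> S_sets X" and G: "G \<subseteq> S_sets X"
    and sub: "pts X \<inter> \<Inter>G \<subseteq> U"
  obtains F where "finite F" "F \<subseteq> G" "pts X \<inter> \<Inter>F \<subseteq> U"
proof -
  have comp: "compactin (top_of X) (pts X - U)"
    using compl_S_set_in_sub[OF X U] X by (simp add: S_space_def)
  have "\<forall>W\<in>(\<lambda>V. pts X - V) ` G. openin (top_of X) W"
    using compl_S_set_in_sub[OF X] G X by (auto simp: S_space_def)
  moreover have "pts X - U \<subseteq> \<Union>((\<lambda>V. pts X - V) ` G)"
    using sub by blast
  ultimately obtain H where "finite H" "H \<subseteq> (\<lambda>V. pts X - V) ` G" "pts X - U \<subseteq> \<Union>H"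
    using comp unfolding compactin_def by metis
  then obtain F where "F \<subseteq> G" "finite F" "H = (\<lambda>V. pts X - V) ` F"
    by (metis finite_subset_image)
  with \<open>pts X - U \<subseteq> \<Union>H\<close> show ?thesis
    by (intro that[of F]) auto
qed

lemma cl_subset_iff:
  assumes "x \<in> pts X" "U \<in> S_sets X"
  shows "cl X x \<subseteq> U \<longleftrightarrow> x \<in> U"
  using assms by (auto simp: cl_def)


lemma C_setsI: "A \<subseteq> S_sets X \<Longrightarrow> pts X \<inter> \<Inter>A \<in> C_sets X"
  by (auto simp: C_sets_def)

text \<open>Enlarging the family that defines \<open>Y\<close> to all S-sets above \<open>Y\<close>
  does not change the intersection. This turns the second clause of \<open>meet_relation\<close>
  into membership in \<open>C_sets\<close>.\<close>

lemma C_sets_iff: "Y \<in> C_sets X \<longleftrightarrow> Y = pts X \<inter> \<Inter>{U \<in> S_sets X. Y \<subseteq> U}" (is "_ \<longleftrightarrow> Y = ?Y")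
proof
  assume "Y \<in> C_sets X"
  then obtain A where A: "A \<subseteq> S_sets X" "Y = pts X \<inter> \<Inter>A"
    by (auto simp: C_sets_def)
  then have "A \<subseteq> {U \<in> S_sets X. Y \<subseteq> U}"
    by blast
  then have "?Y \<subseteq> pts X \<inter> \<Inter>A"
    by (intro Int_mono Inter_anti_mono order_refl)
  moreover have "Y \<subseteq> ?Y"
    using A(2) by blast
  ultimately show "Y = ?Y"
    using A(2) by (metis subset_antisym)
next
  assume "Y = ?Y"
  moreover have "?Y \<in> C_sets X"
    by (rule C_setsI) simp
  ultimately show "Y \<in> C_sets X"
    by metis
qed


section \<open>Meet-relations as finite-intersection-preserving maps\<close>

lemma meet_relation_iff:
  "meet_relation X Y T \<longleftrightarrow> T \<subseteq> pts X \<times> pts Y \<and>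
     (\<forall>U\<in>S_sets Y. boxR X T U \<in> S_sets X) \<and> (\<forall>x\<in>pts X. T `` {x} \<in> C_sets Y)"
  unfolding meet_relation_def C_sets_iff ..

text \<open>The conditions concern only the values on \<open>S_sets Y\<close>; the empty
  intersection is \<open>pts Y\<close>.\<close>

definition meet_map ::
  "('a, 'y) subbased_scheme \<Rightarrow> ('b, 'z) subbased_scheme \<Rightarrow> ('b set \<Rightarrow> 'a set) \<Rightarrow> bool" where
  "meet_map X Y h \<longleftrightarrow> (\<forall>U\<in>S_sets Y. h U \<in> S_sets X) \<and> h (pts Y) = pts X \<and>
     (\<forall>U\<in>S_sets Y. \<forall>V\<in>S_sets Y. h (U \<inter> V) = h U \<inter> h V)"

text \<open>Inverse of the passage from \<open>T\<close> to \<open>boxR X T\<close>: when every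
  \<open>h U\<close> lies in \<open>pts X\<close>, this is the largest \<open>T\<close> between the
  two point sets with \<open>h U\<close> contained in \<open>boxR X T U\<close> for all S-sets
  \<open>U\<close>.\<close>

definition rel_of_map ::
  "('a, 'y) subbased_scheme \<Rightarrow> ('b, 'z) subbased_scheme \<Rightarrow> ('b set \<Rightarrow> 'a set) \<Rightarrow> ('a \<times> 'b) set" where
  "rel_of_map X Y h = {(x, y) \<in> pts X \<times> pts Y. \<forall>U\<in>S_sets Y. x \<in> h U \<longrightarrow> y \<in> U}"

lemma rel_of_map_Image:
  "x \<in> pts X \<Longrightarrow> rel_of_map X Y h `` {x} = pts Y \<inter> \<Inter>{U \<in> S_sets Y. x \<in> h U}"
  by (auto simp: rel_of_map_def)

lemma rel_of_map_cong:
  "(\<And>U. U \<in> S_sets Y \<Longrightarrow> h U = h' U) \<Longrightarrow> rel_of_map X Y h = rel_of_map X Y h'"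
  by (auto simp: rel_of_map_def)

lemma meet_map_finite_Inter:
  assumes Y: "S_space Y" and h: "meet_map X Y h" and "finite F" "F \<subseteq> S_sets Y"
  shows "h (pts Y \<inter> \<Inter>F) = pts X \<inter> \<Inter>(h ` F)"
  using assms(3,4)
proof (induction F rule: finite_induct)
  case empty
  then show ?case using h by (simp add: meet_map_def)
next
  case (insert U F)
  then have "pts Y \<inter> \<Inter>F \<in> S_sets Y"
    by (intro S_sets_finite_Inter[OF Y]) auto
  then have "h (U \<inter> (pts Y \<inter> \<Inter>F)) = h U \<inter> h (pts Y \<inter> \<Inter>F)"
    using h insert.prems by (simp add: meet_map_def)
  with insert show ?case by (simp add: Int_left_commute)
qed

lemma meet_map_mono:
  assumes "meet_map X Y h" "U \<in> S_sets Y" "V \<in> S_sets Y" "U \<subseteq> V"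
  shows "h U \<subseteq> h V"
  using assms unfolding meet_map_def by (metis inf.absorb_iff1 inf.cobounded2)

text \<open>The sets \<open>V\<close> with \<open>x \<in> h V\<close> form a filter, so by compactness their intersection is contained
  only in its members.\<close>

lemma boxR_rel_of_map:
  assumes Y: "S_space Y" and h: "meet_map X Y h" and U: "U \<in> S_sets Y"
  shows "boxR X (rel_of_map X Y h) U = h U"
proof (intro equalityI subsetI)
  fix x assume "x \<in> boxR X (rel_of_map X Y h) U"
  then have x: "x \<in> pts X" and "rel_of_map X Y h `` {x} \<subseteq> U"
    by (auto simp: boxR_def)
  then have "pts Y \<inter> \<Inter>{V \<in> S_sets Y. x \<in> h V} \<subseteq> U"
    by (simp only: rel_of_map_Image)
  then obtain F where F: "finite F" "F \<subseteq> {V \<in> S_sets Y. x \<in> h V}" "pts Y \<inter> \<Inter>F \<subseteq> U"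
    using S_sets_finite_Inter_subset[OF Y U, of "{V \<in> S_sets Y. x \<in> h V}"] by blast
  then have FS: "F \<subseteq> S_sets Y" by auto
  have "x \<in> h (pts Y \<inter> \<Inter>F)"
    using F x by (auto simp: meet_map_finite_Inter[OF Y h F(1) FS])
  then show "x \<in> h U"
    using meet_map_mono[OF h S_sets_finite_Inter[OF Y F(1) FS] U F(3)] by auto
next
  fix x assume "x \<in> h U"
  moreover have "h U \<subseteq> pts X"
    using h U by (auto simp: meet_map_def dest: S_sets_subset)
  ultimately show "x \<in> boxR X (rel_of_map X Y h) U"
    using U by (auto simp: boxR_def rel_of_map_def)
qed

lemma meet_map_boxR:
  assumes "meet_relation X Y T"
  shows "meet_map X Y (boxR X T)"
  using assms by (auto simp: meet_map_def meet_relation_iff boxR_def)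

text \<open>For \<open>h = boxR X T\<close> the filter at \<open>x\<close> consists of the S-sets
  containing \<open>T(x)\<close>, and the closure clause of a meet-relation says that its
  intersection is \<open>T(x)\<close>.\<close>

lemma rel_of_map_boxR:
  assumes "meet_relation X Y T"
  shows "rel_of_map X Y (boxR X T) = T"
proof -
  have "y \<in> T `` {x} \<longleftrightarrow> y \<in> pts Y \<and> (\<forall>U\<in>S_sets Y. T `` {x} \<subseteq> U \<longrightarrow> y \<in> U)"
    if "x \<in> pts X" for x y
  proof -
    have "T `` {x} = pts Y \<inter> \<Inter>{U \<in> S_sets Y. T `` {x} \<subseteq> U}"
      using assms that unfolding meet_relation_def by blast
    then show ?thesis by blast
  qed
  moreover have "T \<subseteq> pts X \<times> pts Y"
    using assms by (simp add: meet_relation_iff)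
  ultimately show ?thesis
    by (auto simp: rel_of_map_def boxR_def)
qed

lemma meet_relation_rel_of_map:
  assumes "S_space Y" "meet_map X Y h"
  shows "meet_relation X Y (rel_of_map X Y h)"
proof -
  have "rel_of_map X Y h `` {x} \<in> C_sets Y" if "x \<in> pts X" for x
    unfolding rel_of_map_Image[OF that] by (rule C_setsI) simp
  moreover have "boxR X (rel_of_map X Y h) U \<in> S_sets X" if "U \<in> S_sets Y" for U
    using boxR_rel_of_map[OF assms that] assms(2) that by (simp add: meet_map_def)
  moreover have "rel_of_map X Y h \<subseteq> pts X \<times> pts Y"
    by (auto simp: rel_of_map_def)
  ultimately show ?thesis by (simp add: meet_relation_iff)
qed

lemma meet_relation_eq_iff:
  assumes "meet_relation X Y T" "meet_relation X Y T'"
  shows "T = T' \<longleftrightarrow> (\<forall>U\<in>S_sets Y. boxR X T U = boxR X T' U)"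
  using rel_of_map_cong[of Y "boxR X T" "boxR X T'" X] rel_of_map_boxR assms by metis

section \<open>Identities and the star product in terms of box operators\<close>

lemma dual_spec_eq_rel_of_map: "dual_spec X = rel_of_map X X (\<lambda>U. U)"
  by (auto simp: dual_spec_def rel_of_map_def cl_def)

lemma meet_map_id: "meet_map X X (\<lambda>U. U)"
  by (simp add: meet_map_def)

lemmas meet_relation_dual_spec =
  meet_relation_rel_of_map[OF _ meet_map_id, folded dual_spec_eq_rel_of_map]

lemmas boxR_dual_spec = boxR_rel_of_map[OF _ meet_map_id, folded dual_spec_eq_rel_of_map]

lemma meet_map_comp:
  "meet_map X Y h \<Longrightarrow> meet_map Y Z k \<Longrightarrow> meet_map X Z (\<lambda>U. h (k U))"
  by (simp add: meet_map_def)

text \<open>The composite sends \<open>x\<close> into \<open>U\<close> exactly when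
  \<open>R(x)\<close> lies in \<open>boxR Y T U\<close>, so the S-sets tested by \<open>star\<close>
  are those in the filter of the composed box operators.\<close>

lemma star_eq_rel_of_map:
  assumes "meet_relation X Y R"
  shows "star X Z T R = rel_of_map X Z (\<lambda>U. boxR X R (boxR Y T U))"
proof -
  have "R \<subseteq> pts X \<times> pts Y"
    using assms by (simp add: meet_relation_iff)
  then have "(R O T) `` {x} \<subseteq> U \<longleftrightarrow> x \<in> boxR X R (boxR Y T U)" if "x \<in> pts X" for x U
    using that by (auto simp: boxR_def)
  then show ?thesis by (auto simp: star_def rel_of_map_def)
qed

lemma
  assumes "S_space Z" "meet_relation X Y R" "meet_relation Y Z T"
  shows meet_relation_star: "meet_relation X Z (star X Z T R)"
    and boxR_star: "U \<in> S_sets Z \<Longrightarrow> boxR X (star X Z T R) U = boxR X R (boxR Y T U)"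
proof -
  note h = meet_map_comp[OF meet_map_boxR[OF assms(2)] meet_map_boxR[OF assms(3)]]
  show "meet_relation X Z (star X Z T R)"
    unfolding star_eq_rel_of_map[OF assms(2)] by (rule meet_relation_rel_of_map[OF assms(1) h])
  show "boxR X (star X Z T R) U = boxR X R (boxR Y T U)" if "U \<in> S_sets Z"
    unfolding star_eq_rel_of_map[OF assms(2)] by (rule boxR_rel_of_map[OF assms(1) h that])
qed

lemma boxR_in_S_sets: "meet_relation X Y T \<Longrightarrow> U \<in> S_sets Y \<Longrightarrow> boxR X T U \<in> S_sets X"
  by (simp add: meet_relation_iff)


section \<open>Multirelations of mS-spaces as monotone maps\<close>

text \<open>Counterpart of \<open>rel_of_map\<close> for \<open>m_op\<close>: when every
  \<open>m U\<close> lies in \<open>pts X\<close>, it is the largest multirelation \<open>R\<close>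
  with \<open>m U\<close> contained in \<open>m_op X R U\<close> for all S-sets
  \<open>U\<close>.\<close>

definition mrel_of_map ::
  "('a, 'z) subbased_scheme \<Rightarrow> ('a set \<Rightarrow> 'a set) \<Rightarrow> ('a \<times> 'a set) set" where
  "mrel_of_map X m = {(x, Z) \<in> pts X \<times> Z_sets X. \<forall>U\<in>S_sets X. x \<in> m U \<longrightarrow> Z \<in> L_set X U}"

lemma mrel_of_map_cong:
  "(\<And>U. U \<in> S_sets X \<Longrightarrow> m U = m' U) \<Longrightarrow> mrel_of_map X m = mrel_of_map X m'"
  by (auto simp: mrel_of_map_def)

lemma compl_S_set_in_Z_sets:
  assumes "S_space X" "U \<in> S_sets X"
  shows "pts X - U \<in> Z_sets X"
  unfolding Z_sets_def
  using compl_S_set_in_sub[OF assms] by (intro CollectI exI[of _ "{pts X - U}"]) auto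

text \<open>The complement of \<open>U\<close> separates a point outside \<open>m U\<close> from \<open>L_set X U\<close>.\<close>

lemma m_op_mrel_of_map:
  assumes X: "S_space X"
    and closed: "\<And>U. U \<in> S_sets X \<Longrightarrow> m U \<in> S_sets X"
    and mono: "\<And>U V. U \<in> S_sets X \<Longrightarrow> V \<in> S_sets X \<Longrightarrow> U \<subseteq> V \<Longrightarrow> m U \<subseteq> m V"
    and U: "U \<in> S_sets X"
  shows "m_op X (mrel_of_map X m) U = m U"
proof (intro equalityI subsetI)
  fix x assume x: "x \<in> m_op X (mrel_of_map X m) U"
  show "x \<in> m U"
  proof (rule ccontr)
    assume nx: "x \<notin> m U"
    \<comment> \<open>Monotonicity enters here: \<open>V \<subseteq> U\<close> would put
      \<open>x\<close> into \<open>m U\<close>, so \<open>V\<close> meets the complement of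
      \<open>U\<close>.\<close>
    have "pts X - U \<in> L_set X V" if V: "V \<in> S_sets X" "x \<in> m V" for V
    proof -
      have "\<not> V \<subseteq> U"
        using mono[OF V(1) U] V(2) nx by auto
      then show ?thesis
        using S_sets_subset[OF V(1)] compl_S_set_in_Z_sets[OF X U] by (auto simp: L_set_def)
    qed
    then have "pts X - U \<in> mrel_of_map X m `` {x}"
      using x compl_S_set_in_Z_sets[OF X U] by (simp add: mrel_of_map_def m_op_def)
    with x show False by (auto simp: m_op_def L_set_def)
  qed
next
  fix x assume "x \<in> m U"
  then show "x \<in> m_op X (mrel_of_map X m) U"
    using S_sets_subset[OF closed[OF U]] U by (auto simp: m_op_def mrel_of_map_def)
qed

text \<open>Condition (m2) and the typing of \<open>R\<close> together become one fixed-point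
  equation, because \<open>mrel_of_map\<close> always yields a relation from points to
  \<open>Z_sets X\<close>.\<close>

lemma mS_space_iff:
  "mS_space X R \<longleftrightarrow> S_space X \<and> (\<forall>U\<in>S_sets X. m_op X R U \<in> S_sets X) \<and>
     mrel_of_map X (m_op X R) = R" (is "_ \<longleftrightarrow> ?rhs")
proof -
  have "R \<subseteq> pts X \<times> Z_sets X \<and> (\<forall>x\<in>pts X. R `` {x} =
      Z_sets X \<inter> \<Inter>{L_set X U | U. U \<in> S_sets X \<and> x \<in> m_op X R U}) \<longleftrightarrow>
    mrel_of_map X (m_op X R) = R" (is "?P \<and> ?Q \<longleftrightarrow> ?E")
  proof -
    let ?M = "mrel_of_map X (m_op X R)"
    have M: "?M `` {x} = Z_sets X \<inter> \<Inter>{L_set X U | U. U \<in> S_sets X \<and> x \<in> m_op X R U}"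
      if "x \<in> pts X" for x
      using that by (auto simp: mrel_of_map_def)
    have P: "?M \<subseteq> pts X \<times> Z_sets X"
      by (auto simp: mrel_of_map_def)
    have "?E" if "?P" "?Q"
    proof -
      have "?M `` {x} = R `` {x}" if "x \<in> pts X" for x
        using M[OF that] \<open>?Q\<close> that by blast
      with P \<open>?P\<close> show ?thesis by blast
    qed
    moreover have "?P \<and> ?Q" if "?E"
      using M P unfolding that by blast
    ultimately show ?thesis by blast
  qed
  then show ?thesis unfolding mS_space_def by blast
qed

lemma mS_space_mrel_of_map:
  assumes "S_space X"
    and "\<And>U. U \<in> S_sets X \<Longrightarrow> m U \<in> S_sets X"
    and "\<And>U V. U \<in> S_sets X \<Longrightarrow> V \<in> S_sets X \<Longrightarrow> U \<subseteq> V \<Longrightarrow> m U \<subseteq> m V"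
  shows "mS_space X (mrel_of_map X m)"
proof -
  have "m_op X (mrel_of_map X m) U = m U" if "U \<in> S_sets X" for U
    using m_op_mrel_of_map[of X m U] assms that by blast
  then show ?thesis
    unfolding mS_space_iff using assms(1,2) mrel_of_map_cong by metis
qed

lemma m_op_mono: "U \<subseteq> V \<Longrightarrow> m_op X R U \<subseteq> m_op X R V"
  by (auto simp: m_op_def L_set_def)


section \<open>Adjunctions\<close>

text \<open>(A2) is the unit and (A3) the counit of the adjunction between the two
  operators.\<close>

lemma SLata_space_iff:
  "SLata_space X \<longleftrightarrow> mS_space X (relI X) \<and> mS_space X (relE X) \<and>
     (\<forall>U\<in>S_sets X. U \<subseteq> m_op X (relE X) (m_op X (relI X) U)) \<and>
     (\<forall>U\<in>S_sets X. m_op X (relI X) (m_op X (relE X) U) \<subseteq> U)"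
proof (cases "mS_space X (relI X) \<and> mS_space X (relE X)")
  case True
  \<comment> \<open>Members of \<open>Z_sets X\<close> consist of points, so such a \<open>w\<close>
    is a common element of \<open>Z\<close> and \<open>m_op X R U\<close>. The nested quantifiers in
    (A2) and (A3) thereby become iterated operators.\<close>
  have dia: "(\<exists>w\<in>Z. R `` {w} \<subseteq> L_set X U) \<longleftrightarrow> Z \<in> L_set X (m_op X R U)"
    if "(x, Z) \<in> Q" "mS_space X Q" for x Z and R Q :: "('a \<times> 'a set) set" and U
  proof -
    have "S_space X" "Z \<in> Z_sets X"
      using that by (auto simp: mS_space_def)
    moreover from this have "Z \<subseteq> pts X"
      by (auto simp: Z_sets_def S_space_def)
    ultimately show ?thesis
      by (auto simp: L_set_def m_op_def)
  qed
  have A2: "(\<forall>Z\<in>relE X `` {x}. \<exists>w\<in>Z. relI X `` {w} \<subseteq> L_set X U) \<longleftrightarrow>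
      x \<in> m_op X (relE X) (m_op X (relI X) U)" if "x \<in> pts X" for x U
    using dia[of x _ "relE X"] True that by (auto simp: m_op_def[of X "relE X"])
  have A3: "(\<forall>Z\<in>relI X `` {x}. \<exists>w\<in>Z. relE X `` {w} \<subseteq> L_set X U) \<longleftrightarrow>
      x \<in> m_op X (relI X) (m_op X (relE X) U)" if "x \<in> pts X" for x U
    using dia[of x _ "relI X"] True that by (auto simp: m_op_def[of X "relI X"])
  have "(\<forall>x\<in>pts X. x \<in> U \<longrightarrow> (\<forall>Z\<in>relE X `` {x}. \<exists>w\<in>Z. relI X `` {w} \<subseteq> L_set X U)) \<longleftrightarrow>
      U \<subseteq> m_op X (relE X) (m_op X (relI X) U)" if "U \<in> S_sets X" for U
    using A2 S_sets_subset[OF that] by blast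
  moreover have "m_op X (relI X) V \<subseteq> pts X" for V
    by (auto simp: m_op_def)
  then have "(\<forall>x\<in>pts X. (\<forall>Z\<in>relI X `` {x}. \<exists>w\<in>Z. relE X `` {w} \<subseteq> L_set X U) \<longrightarrow> x \<in> U) \<longleftrightarrow>
      m_op X (relI X) (m_op X (relE X) U) \<subseteq> U" for U
    using A3 by blast
  ultimately show ?thesis
    unfolding SLata_space_def conj_assoc by (intro conj_cong ball_cong refl)
qed (auto simp: SLata_space_def)

lemma
  assumes "SLata_space X"
  shows SLata_S_space: "S_space X"
    and SLata_mI: "U \<in> S_sets X \<Longrightarrow> m_op X (relI X) U \<in> S_sets X"
    and SLata_mE: "U \<in> S_sets X \<Longrightarrow> m_op X (relE X) U \<in> S_sets X"
    and SLata_unit: "U \<in> S_sets X \<Longrightarrow> U \<subseteq> m_op X (relE X) (m_op X (relI X) U)"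
    and SLata_counit: "U \<in> S_sets X \<Longrightarrow> m_op X (relI X) (m_op X (relE X) U) \<subseteq> U"
  using assms by (simp_all add: SLata_space_iff mS_space_def)

lemma SLata_adjunction:
  assumes "SLata_space X" "U \<in> S_sets X" "V \<in> S_sets X"
  shows "m_op X (relI X) U \<subseteq> V \<longleftrightarrow> U \<subseteq> m_op X (relE X) V"
  using assms SLata_unit SLata_counit m_op_mono by (metis subset_trans)

text \<open>A right adjoint preserves finite meets.\<close>

lemma meet_map_mE:
  assumes X: "SLata_space X"
  shows "meet_map X X (m_op X (relE X))"
  unfolding meet_map_def
proof (intro conjI ballI)
  let ?e = "m_op X (relE X)" and ?i = "m_op X (relI X)"
  note S = SLata_S_space[OF X] and e = SLata_mE[OF X] and i = SLata_mI[OF X]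
  show "?e (pts X) = pts X"
    using SLata_adjunction[OF X pts_in_S_sets[OF S] pts_in_S_sets[OF S]]
      S_sets_subset[OF i[OF pts_in_S_sets[OF S]]]
    by (auto simp: m_op_def)
  fix U V assume U: "U \<in> S_sets X" and V: "V \<in> S_sets X"
  show "?e (U \<inter> V) = ?e U \<inter> ?e V"
  proof
    have W: "?e U \<inter> ?e V \<in> S_sets X" "U \<inter> V \<in> S_sets X"
      using S_sets_Int[OF S] e U V by auto
    \<comment> \<open>Transposing the inclusions of \<open>?e U \<inter> ?e V\<close> in
      \<open>?e U\<close> and in \<open>?e V\<close> bounds its image by \<open>U\<close> and by
      \<open>V\<close>.\<close>
    have "?i (?e U \<inter> ?e V) \<subseteq> U \<inter> V"
      using SLata_adjunction[OF X W(1)] U V by simp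
    then show "?e U \<inter> ?e V \<subseteq> ?e (U \<inter> V)"
      using SLata_adjunction[OF X W] by simp
  qed (simp add: m_op_mono)
qed (rule SLata_mE[OF X])

text \<open>The standard formula for the left adjoint of \<open>boxR X T\<close>. The second
  condition on an A-relation says that its values stay in \<open>S_sets X\<close>.\<close>

definition diaR :: "('a, 'z) subbased_scheme \<Rightarrow> ('a \<times> 'a) set \<Rightarrow> 'a set \<Rightarrow> 'a set" where
  "diaR X T U = pts X \<inter> \<Inter>(F_set X T U)"

lemma
  assumes "RelS_space X"
  shows RelS_S_space: "S_space X"
    and RelS_meet_relation: "meet_relation X X (relT X)"
    and RelS_diaR: "U \<in> S_sets X \<Longrightarrow> diaR X (relT X) U \<in> S_sets X"
  using assms by (simp_all add: RelS_space_def A_relation_def meet_relation_iff diaR_def)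

lemma diaR_mono: "U \<subseteq> V \<Longrightarrow> diaR X T U \<subseteq> diaR X T V"
  by (auto simp: diaR_def F_set_def)

text \<open>\<open>U\<close> may be any set of points: a point of \<open>U\<close> has its
  \<open>T\<close>-image inside every member of \<open>F_set X T U\<close>, hence inside their
  intersection.\<close>

lemma diaR_unit:
  assumes "T \<subseteq> pts X \<times> pts X" "U \<subseteq> pts X"
  shows "U \<subseteq> boxR X T (diaR X T U)"
  using assms by (auto simp: boxR_def diaR_def F_set_def)

lemma diaR_counit: "U \<in> S_sets X \<Longrightarrow> diaR X T (boxR X T U) \<subseteq> U"
  by (auto simp: boxR_def diaR_def F_set_def)

lemma RelS_adjunction:
  assumes X: "RelS_space X" and U: "U \<in> S_sets X" and V: "V \<in> S_sets X"
  shows "diaR X (relT X) U \<subseteq> V \<longleftrightarrow> U \<subseteq> boxR X (relT X) V"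
proof
  have T: "relT X \<subseteq> pts X \<times> pts X"
    using RelS_meet_relation[OF X] by (simp add: meet_relation_iff)
  assume "diaR X (relT X) U \<subseteq> V"
  then show "U \<subseteq> boxR X (relT X) V"
    using diaR_unit[OF T S_sets_subset[OF U]] by (force simp: boxR_def)
next
  assume "U \<subseteq> boxR X (relT X) V"
  then show "diaR X (relT X) U \<subseteq> V"
    using diaR_mono diaR_counit[OF V] by (meson subset_trans)
qed

text \<open>Condition (2) is commutation with the box operators, by comparing the boxes of both star
  products. Condition (3) then supplies the inclusion between the left adjoints that commutation
  does not.\<close>

lemma adjoint_preserving_iff:
  assumes X: "RelS_space X" and Y: "RelS_space Y"
  shows "adjoint_preserving X Y M \<longleftrightarrow> meet_relation X Y M \<and>
    (\<forall>V\<in>S_sets Y. boxR X M (boxR Y (relT Y) V) = boxR X (relT X) (boxR X M V)) \<and>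
    (\<forall>V\<in>S_sets Y. boxR X M (diaR Y (relT Y) V) = diaR X (relT X) (boxR X M V))"
proof (cases "meet_relation X Y M")
  case M: True
  note TX = RelS_meet_relation[OF X] and TY = RelS_meet_relation[OF Y]
  note SY = RelS_S_space[OF Y]
  let ?comm = "\<forall>V\<in>S_sets Y. boxR X M (boxR Y (relT Y) V) = boxR X (relT X) (boxR X M V)"
  have comm: "star X Y M (relT X) = star X Y (relT Y) M \<longleftrightarrow> ?comm"
    unfolding meet_relation_eq_iff[OF meet_relation_star[OF SY TX M] meet_relation_star[OF SY M TY]]
    using boxR_star[OF SY TX M] boxR_star[OF SY M TY] by (metis (no_types, lifting))
  \<comment> \<open>The images under \<open>M\<close> and \<open>relT X\<close> are in
    \<open>C_sets\<close>, so membership in a \<open>D_set\<close> reduces to inclusion.\<close>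
  have 1: "(\<forall>x\<in>pts X. M `` {x} \<in> D_set Y V \<longrightarrow> relT X `` {x} \<in> D_set X U) \<longleftrightarrow>
      boxR X M V \<subseteq> boxR X (relT X) U" for U V
    using M TX by (auto simp: meet_relation_iff D_set_def boxR_def)
  have 2: "(\<forall>x\<in>pts X. M `` {x} \<in> (\<Inter>W\<in>F_set Y (relT Y) V. D_set Y W) \<longrightarrow> cl X x \<in> D_set X U) \<longleftrightarrow>
      boxR X M (diaR Y (relT Y) V) \<subseteq> U" if U: "U \<in> S_sets X" for U V
  proof -
    have "cl X x \<in> C_sets X" for x
      unfolding cl_def C_sets_def by blast
    then have "cl X x \<in> D_set X U \<longleftrightarrow> x \<in> U" if "x \<in> pts X" for x
      using cl_subset_iff[OF that U] by (simp add: D_set_def)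
    moreover have "M `` {x} \<subseteq> pts Y" for x
      using M by (auto simp: meet_relation_iff)
    then have "M `` {x} \<in> (\<Inter>W\<in>F_set Y (relT Y) V. D_set Y W) \<longleftrightarrow>
        M `` {x} \<subseteq> diaR Y (relT Y) V" if "x \<in> pts X" for x
      using M that by (auto simp: meet_relation_iff diaR_def D_set_def)
    ultimately show ?thesis
      by (auto simp: boxR_def)
  qed
  have 3: "(\<forall>U\<in>S_sets X. boxR X M V \<subseteq> boxR X (relT X) U \<longrightarrow> boxR X M (diaR Y (relT Y) V) \<subseteq> U) \<longleftrightarrow>
      boxR X M (diaR Y (relT Y) V) = diaR X (relT X) (boxR X M V)" (is "?l \<longleftrightarrow> ?r")
    if ?comm and V: "V \<in> S_sets Y" for V
  proof -
    note MV = boxR_in_S_sets[OF M V]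
    note dV = RelS_diaR[OF Y V]
    \<comment> \<open>By adjunction the premise says
      \<open>diaR X (relT X) (boxR X M V) \<subseteq> U\<close>; this diamond is itself an
      admissible \<open>U\<close>, and the least one.\<close>
    have "?l \<longleftrightarrow> boxR X M (diaR Y (relT Y) V) \<subseteq> diaR X (relT X) (boxR X M V)"
      using RelS_adjunction[OF X MV] RelS_diaR[OF X MV] by (meson order_refl subset_trans)
    moreover have "diaR X (relT X) (boxR X M V) \<subseteq> boxR X M (diaR Y (relT Y) V)"
    proof -
      \<comment> \<open>Apply \<open>boxR X M\<close> to the unit in \<open>Y\<close>, commute it
        past the box, and transpose in \<open>X\<close>.\<close>
      have "boxR X M V \<subseteq> boxR X M (boxR Y (relT Y) (diaR Y (relT Y) V))"
        using RelS_adjunction[OF Y V dV] by (intro meet_map_mono[OF meet_map_boxR[OF M] V]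
            boxR_in_S_sets[OF TY dV]) simp
      then have "boxR X M V \<subseteq> boxR X (relT X) (boxR X M (diaR Y (relT Y) V))"
        using \<open>?comm\<close> dV by simp
      then show ?thesis
        using RelS_adjunction[OF X MV boxR_in_S_sets[OF M dV]] by simp
    qed
    ultimately show ?thesis by auto
  qed
  have "(\<forall>U\<in>S_sets X. \<forall>V\<in>S_sets Y.
        (\<forall>x\<in>pts X. M `` {x} \<in> D_set Y V \<longrightarrow> relT X `` {x} \<in> D_set X U) \<longrightarrow>
        (\<forall>x\<in>pts X. M `` {x} \<in> (\<Inter>W\<in>F_set Y (relT Y) V. D_set Y W) \<longrightarrow> cl X x \<in> D_set X U)) \<longleftrightarrow>
      (\<forall>V\<in>S_sets Y. boxR X M (diaR Y (relT Y) V) = diaR X (relT X) (boxR X M V))"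
    (is "?cond3 \<longleftrightarrow> ?dia") if ?comm
  proof -
    have "?cond3 \<longleftrightarrow> (\<forall>U\<in>S_sets X. \<forall>V\<in>S_sets Y.
        boxR X M V \<subseteq> boxR X (relT X) U \<longrightarrow> boxR X M (diaR Y (relT Y) V) \<subseteq> U)"
      unfolding 1 by (intro ball_cong imp_cong refl 2)
    also have "\<dots> \<longleftrightarrow> ?dia"
      using 3[OF that] by blast
    finally show ?thesis .
  qed
  then show ?thesis
    unfolding adjoint_preserving_def comm by (intro conj_cong refl)
qed (simp add: adjoint_preserving_def)


section \<open>The two object maps\<close>

definition rels_of :: "'a slata \<Rightarrow> 'a rels" where
  "rels_of X = \<lparr>pts = pts X, sub = sub X, relT = rel_of_map X X (m_op X (relE X))\<rparr>"

definition slata_of :: "'a rels \<Rightarrow> 'a slata" where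
  "slata_of X = \<lparr>pts = pts X, sub = sub X,
     relI = mrel_of_map X (diaR X (relT X)), relE = mrel_of_map X (boxR X (relT X))\<rparr>"

text \<open>Only the carrier and the subbase of a space enter the notions below, so that they
  do not distinguish records of different types with the same underlying space.\<close>

lemma same_space:
  fixes X :: "('a, 'y) subbased_scheme" and X' :: "('a, 'z) subbased_scheme"
  assumes [simp]: "pts X' = pts X" "sub X' = sub X"
  shows "S_sets X' = S_sets X" "C_sets X' = C_sets X" "Z_sets X' = Z_sets X"
    "L_set X' = L_set X" "S_space X' = S_space X" "(boxR X' :: ('a \<times> 'b) set \<Rightarrow> _) = boxR X"
    "m_op X' = m_op X" "mS_space X' = mS_space X" "dual_spec X' = dual_spec X"
    "diaR X' = diaR X" "rel_of_map X' X' = rel_of_map X X" "mrel_of_map X' = mrel_of_map X"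
proof -
  show S [simp]: "S_sets X' = S_sets X" by (simp add: S_sets_def)
  show C [simp]: "C_sets X' = C_sets X" by (simp add: C_sets_def)
  show Z [simp]: "Z_sets X' = Z_sets X" by (simp add: Z_sets_def)
  show L [simp]: "L_set X' = L_set X" by (simp add: L_set_def fun_eq_iff)
  have [simp]: "top_of X' = top_of X" by (simp add: top_of_def)
  have [simp]: "Y_family X' = Y_family X" by (simp add: Y_family_def fun_eq_iff)
  show [simp]: "S_space X' = S_space X" by (simp add: S_space_def)
  show "(boxR X' :: ('a \<times> 'b) set \<Rightarrow> _) = boxR X" by (simp add: boxR_def fun_eq_iff)
  show [simp]: "m_op X' = m_op X" by (simp add: m_op_def fun_eq_iff)
  show "mS_space X' = mS_space X" by (simp add: mS_space_def fun_eq_iff)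
  show "dual_spec X' = dual_spec X" by (simp add: dual_spec_def cl_def)
  show "diaR X' = diaR X" by (simp add: diaR_def F_set_def boxR_def fun_eq_iff)
  show "rel_of_map X' X' = rel_of_map X X" by (simp add: rel_of_map_def fun_eq_iff)
  show "mrel_of_map X' = mrel_of_map X" by (simp add: mrel_of_map_def fun_eq_iff)
qed

lemma rels_of_simps [simp]:
  "pts (rels_of X) = pts X" "sub (rels_of X) = sub X"
  by (simp_all add: rels_of_def)

lemma slata_of_simps [simp]:
  "pts (slata_of X) = pts X" "sub (slata_of X) = sub X"
  by (simp_all add: slata_of_def)

lemmas rels_of_same [simp] = same_space[OF rels_of_simps]

lemmas slata_of_same [simp] = same_space[OF slata_of_simps]

lemma meet_relation_rels_of [simp]: "meet_relation (rels_of X) (rels_of Y) = meet_relation X Y"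
  by (simp add: meet_relation_iff fun_eq_iff)

lemma star_rels_of [simp]: "star (rels_of X) (rels_of Z) T R = star X Z T R"
  by (simp add: star_def)

section \<open>The object maps are well defined and mutually inverse\<close>

lemma boxR_relT_rels_of:
  assumes "SLata_space X" "U \<in> S_sets X"
  shows "boxR X (relT (rels_of X)) U = m_op X (relE X) U"
  using boxR_rel_of_map[OF SLata_S_space[OF assms(1)] meet_map_mE[OF assms(1)] assms(2)]
  by (simp add: rels_of_def)

lemma diaR_relT_rels_of:
  assumes X: "SLata_space X" and U: "U \<in> S_sets X"
  shows "diaR X (relT (rels_of X)) U = m_op X (relI X) U"
proof -
  \<comment> \<open>By adjunction the family consists of the S-sets above
    \<open>m_op X (relI X) U\<close>, which is its own least member.\<close>
  have "F_set X (relT (rels_of X)) U = {V \<in> S_sets X. m_op X (relI X) U \<subseteq> V}"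
    unfolding F_set_def
    by (intro Collect_cong conj_cong refl)
      (simp add: boxR_relT_rels_of[OF X] SLata_adjunction[OF X U])
  then show ?thesis
    using SLata_mI[OF X U] S_sets_subset by (fastforce simp: diaR_def)
qed

lemma RelS_space_rels_of:
  assumes X: "SLata_space X"
  shows "RelS_space (rels_of X)"
proof -
  have M: "meet_relation X X (relT (rels_of X))"
    using meet_relation_rel_of_map[OF SLata_S_space[OF X] meet_map_mE[OF X]]
    by (simp add: rels_of_def)
  have "pts X \<inter> \<Inter>(F_set (rels_of X) (relT (rels_of X)) U) \<in> S_sets X" if "U \<in> S_sets X" for U
    using diaR_relT_rels_of[OF X that] SLata_mI[OF X that]
    by (simp add: F_set_def diaR_def)
  with M SLata_S_space[OF X] show ?thesis
    by (simp add: RelS_space_def A_relation_def meet_relation_iff)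
qed

text \<open>Recovering an operator from its multirelation takes only monotonicity, so this also
  covers \<open>diaR\<close>, which as a left adjoint need not preserve intersections.\<close>

lemma
  assumes X: "RelS_space X" and U: "U \<in> S_sets X"
  shows m_op_relE_slata_of: "m_op X (relE (slata_of X)) U = boxR X (relT X) U"
    and m_op_relI_slata_of: "m_op X (relI (slata_of X)) U = diaR X (relT X) U"
proof -
  note T = RelS_meet_relation[OF X]
  show "m_op X (relE (slata_of X)) U = boxR X (relT X) U"
    unfolding slata_of_def slata.simps
    by (rule m_op_mrel_of_map[OF RelS_S_space[OF X] boxR_in_S_sets[OF T]
          meet_map_mono[OF meet_map_boxR[OF T]] U])
  show "m_op X (relI (slata_of X)) U = diaR X (relT X) U"
    unfolding slata_of_def slata.simps
    by (rule m_op_mrel_of_map[OF RelS_S_space[OF X] RelS_diaR[OF X] diaR_mono U])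
qed

lemma SLata_space_slata_of:
  assumes X: "RelS_space X"
  shows "SLata_space (slata_of X)"
proof -
  note T = RelS_meet_relation[OF X] and S = RelS_S_space[OF X]
  have "mS_space X (relE (slata_of X))"
    unfolding slata_of_def slata.simps
    by (rule mS_space_mrel_of_map[OF S boxR_in_S_sets[OF T]
          meet_map_mono[OF meet_map_boxR[OF T]]])
  moreover have "mS_space X (relI (slata_of X))"
    unfolding slata_of_def slata.simps
    by (rule mS_space_mrel_of_map[OF S RelS_diaR[OF X] diaR_mono])
  moreover have "U \<subseteq> boxR X (relT X) (diaR X (relT X) U)" if "U \<in> S_sets X" for U
    using RelS_adjunction[OF X that RelS_diaR[OF X that]] by simp
  ultimately show ?thesis
    unfolding SLata_space_iff
    by (simp add: m_op_relE_slata_of[OF X] m_op_relI_slata_of[OF X] RelS_diaR[OF X]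
        boxR_in_S_sets[OF T] diaR_counit)
qed

lemma rels_of_slata_of:
  assumes X: "RelS_space X"
  shows "rels_of (slata_of X) = X"
proof -
  have "rel_of_map X X (m_op X (relE (slata_of X))) = rel_of_map X X (boxR X (relT X))"
    by (rule rel_of_map_cong) (rule m_op_relE_slata_of[OF X])
  also have "\<dots> = relT X"
    by (rule rel_of_map_boxR[OF RelS_meet_relation[OF X]])
  finally show ?thesis by (simp add: rels_of_def)
qed

lemma slata_of_rels_of:
  assumes X: "SLata_space X"
  shows "slata_of (rels_of X) = X"
proof -
  have "mrel_of_map X (m_op X (relE X)) = relE X" "mrel_of_map X (m_op X (relI X)) = relI X"
    using X by (simp_all add: SLata_space_iff mS_space_iff)
  moreover have "mrel_of_map X (boxR X (relT (rels_of X))) = mrel_of_map X (m_op X (relE X))"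
    by (rule mrel_of_map_cong) (rule boxR_relT_rels_of[OF X])
  moreover have "mrel_of_map X (diaR X (relT (rels_of X))) = mrel_of_map X (m_op X (relI X))"
    by (rule mrel_of_map_cong) (rule diaR_relT_rels_of[OF X])
  ultimately show ?thesis by (simp add: slata_of_def)
qed

text \<open>Both notions ask for a meet-relation whose box commutes with the same two operators, so
  the hom-sets coincide literally.\<close>

lemma adjoint_preserving_rels_of:
  assumes X: "SLata_space X" and Y: "SLata_space Y"
  shows "adjoint_preserving (rels_of X) (rels_of Y) M \<longleftrightarrow> SLata_relation X Y M"
  unfolding adjoint_preserving_iff[OF RelS_space_rels_of[OF X] RelS_space_rels_of[OF Y]]
  by (auto simp: SLata_relation_def monotone_rel_def boxR_relT_rels_of X Y
      diaR_relT_rels_of boxR_in_S_sets)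


section \<open>The categories\<close>

lemma SLata_relation_dual_spec:
  assumes "SLata_space X"
  shows "SLata_relation X X (dual_spec X)"
  using SLata_S_space[OF assms]
  by (simp add: SLata_relation_def monotone_rel_def meet_relation_dual_spec boxR_dual_spec
      SLata_mI[OF assms] SLata_mE[OF assms])

lemma SLata_relation_star:
  assumes "SLata_space Y" "SLata_space Z" "SLata_relation X Y R" "SLata_relation Y Z T"
  shows "SLata_relation X Z (star X Z T R)"
  using assms SLata_S_space[OF assms(2)]
  by (simp add: SLata_relation_def monotone_rel_def meet_relation_star[of Z X Y]
      boxR_star[of Z X Y] SLata_mI SLata_mE boxR_in_S_sets[of Y Z])

lemma star_dual_spec:
  assumes "S_space X" "S_space Y" "meet_relation X Y T"
  shows "star X Y T (dual_spec X) = T" "star X Y (dual_spec Y) T = T"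
proof -
  note dX = meet_relation_dual_spec[OF assms(1)] and dY = meet_relation_dual_spec[OF assms(2)]
  show "star X Y T (dual_spec X) = T"
    by (subst meet_relation_eq_iff[OF meet_relation_star[OF assms(2) dX assms(3)] assms(3)])
      (simp add: boxR_star[OF assms(2) dX assms(3)] boxR_dual_spec assms(1)
        boxR_in_S_sets[OF assms(3)])
  show "star X Y (dual_spec Y) T = T"
    by (subst meet_relation_eq_iff[OF meet_relation_star[OF assms(2,3) dY] assms(3)])
      (simp add: boxR_star[OF assms(2,3) dY] boxR_dual_spec assms(2))
qed

text \<open>Under \<open>boxR\<close> both sides become the same threefold composite of
  maps.\<close>

lemma star_assoc:
  assumes Y: "S_space Y" and Z: "S_space Z" and W: "S_space W"
    and R: "meet_relation X Y R" and T: "meet_relation Y Z T" and Q: "meet_relation Z W Q"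
  shows "star X W (star Y W Q T) R = star X W Q (star X Z T R)"
proof -
  note QT = meet_relation_star[OF W T Q] and TR = meet_relation_star[OF Z R T]
  show ?thesis
    by (subst meet_relation_eq_iff[OF meet_relation_star[OF W R QT] meet_relation_star[OF W TR Q]])
      (simp add: boxR_star[OF W R QT] boxR_star[OF W TR Q] boxR_star[OF W T Q] boxR_star[OF Z R T]
        boxR_in_S_sets[OF Q])
qed

lemma is_category_SLataSp: "is_category SLataSp"
proof -
  have M: "meet_relation X Y T" if "SLata_relation X Y T" for X Y :: "'a slata" and T
    using that by (simp add: SLata_relation_def)
  show ?thesis
    unfolding is_category_def SLataSp_def category_data.simps mem_Collect_eq
    \<comment> \<open>The optional \<open>rule\<close> call applies to the unit and associativity
      equations; the other goals are closure of the hom-sets.\<close>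
    by (intro conjI ballI allI impI; unfold mem_Collect_eq)
      ((rule star_dual_spec star_assoc)?;
        blast intro: SLata_relation_dual_spec SLata_relation_star SLata_S_space M)+
qed

text \<open>Since the arrow data agree along the bijection of objects, the arrow maps are identities
  and the category axioms of \<open>D\<close> are those of \<open>C\<close> read at
  \<open>G\<close>.\<close>

lemma inverse_bijections_imp_isomorphic_categories:
  assumes C: "is_category C"
    and F: "\<And>a. a \<in> Obj C \<Longrightarrow> F a \<in> Obj D" and G: "\<And>b. b \<in> Obj D \<Longrightarrow> G b \<in> Obj C"
    and GF: "\<And>a. a \<in> Obj C \<Longrightarrow> G (F a) = a" and FG: "\<And>b. b \<in> Obj D \<Longrightarrow> F (G b) = b"
    and Hom: "\<And>a b. a \<in> Obj C \<Longrightarrow> b \<in> Obj C \<Longrightarrow> Hom D (F a) (F b) = Hom C a b"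
    and Ident: "\<And>a. a \<in> Obj C \<Longrightarrow> Ident D (F a) = Ident C a"
    and Comp: "\<And>a b c. a \<in> Obj C \<Longrightarrow> b \<in> Obj C \<Longrightarrow> c \<in> Obj C \<Longrightarrow>
      Comp D (F a) (F b) (F c) = Comp C a b c"
  shows "isomorphic_categories C D"
proof -
  have Hom': "Hom D a b = Hom C (G a) (G b)" if "a \<in> Obj D" "b \<in> Obj D" for a b
    using Hom[of "G a" "G b"] G FG that by simp
  have Ident': "Ident D a = Ident C (G a)" if "a \<in> Obj D" for a
    using Ident[of "G a"] G FG that by simp
  have Comp': "Comp D a b c = Comp C (G a) (G b) (G c)" if "a \<in> Obj D" "b \<in> Obj D" "c \<in> Obj D" for a b c
    using Comp[of "G a" "G b" "G c"] G FG that by simp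
  have "is_category D"
    using C unfolding is_category_def by (simp add: Hom' Ident' Comp' G)
  moreover have "is_functor C D F (\<lambda>_ _ f. f)" "is_functor D C G (\<lambda>_ _ f. f)"
    by (simp_all add: is_functor_def F G GF Hom' Ident' Comp')
  moreover have "left_inverse_functor C F (\<lambda>_ _ f. f) G (\<lambda>_ _ f. f)"
    "left_inverse_functor D G (\<lambda>_ _ f. f) F (\<lambda>_ _ f. f)"
    by (simp_all add: left_inverse_functor_def GF FG)
  ultimately show ?thesis
    using C unfolding isomorphic_categories_def by blast
qed

theorem theorem4p4:
  shows "isomorphic_categories
           (SLataSp :: ('a slata, ('a \<times> 'a) set) category_data)
           (RelSP :: ('a rels, ('a \<times> 'a) set) category_data)"
proof (rule inverse_bijections_imp_isomorphic_categories[
      where F = rels_of and G = slata_of, OF is_category_SLataSp])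
qed (auto simp: SLataSp_def RelSP_def RelS_space_rels_of SLata_space_slata_of slata_of_rels_of
    rels_of_slata_of adjoint_preserving_rels_of fun_eq_iff)

end
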